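(* Let $A,B$ be $n\times n$ Hermitian positive definite matrices, and let $t\in[0,1]$. Then $$\delta_S^2(A^t,B^t)\le t\,\delta_S^2(A,B).$$ Moreover, if $t\ge 1$, then the inequality gets reversed, i.e. $\delta_S^2(A^t,B^t)\ge t\,\delta_S^2(A,B)$.
   Context: For Hermitian positive definite $X,Y$: $\delta_S^2(X,Y):=\log\det\left(\frac{X+Y}{2}\right)-\frac12\log\det(XY)$. *)

theory Defs
  imports "Jordan_Normal_Form.Schur_Decomposition" Complex_Main
begin

definition hermitian_mat :: "complex mat \<Rightarrow> bool" where
  "hermitian_mat A \<longleftrightarrow> square_mat A \<and> mat_adjoint A = A"

(* With \<bullet>c conjugating its right argument, (A *\<^sub>v x) \<bullet>c x is x^* A x,
   which is real for Hermitian A. *)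
definition hermitian_pos_def :: "complex mat \<Rightarrow> bool" where
  "hermitian_pos_def A \<longleftrightarrow> hermitian_mat A \<and>
     (\<forall>x \<in> carrier_vec (dim_row A). x \<noteq> 0\<^sub>v (dim_row A) \<longrightarrow> 0 < Re ((A *\<^sub>v x) \<bullet>c x))"

definition unitary_mat :: "complex mat \<Rightarrow> bool" where
  "unitary_mat U \<longleftrightarrow> square_mat U \<and>
     U * mat_adjoint U = 1\<^sub>m (dim_row U) \<and> mat_adjoint U * U = 1\<^sub>m (dim_row U)"

(* Real power of a Hermitian positive definite matrix by functional calculus:
   if A = U diag(d_0,...,d_(n-1)) U^* with U unitary and all d_i > 0, then
   A^t = U diag(d_0^t,...,d_(n-1)^t) U^*.  The result does not depend on the chosen
   spectral decomposition; the value is unspecified if A has no decomposition of this form,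
   i.e. if A is not Hermitian positive definite. *)
definition mat_powr :: "complex mat \<Rightarrow> real \<Rightarrow> complex mat" where
  "mat_powr A t = (THE B. \<exists>U d. unitary_mat U \<and> dim_row U = dim_row A \<and>
     (\<forall>i < dim_row A. 0 < d i) \<and>
     A = U * mat_diag (dim_row A) (\<lambda>i. complex_of_real (d i)) * mat_adjoint U \<and>
     B = U * mat_diag (dim_row A) (\<lambda>i. complex_of_real (d i powr t)) * mat_adjoint U)"

(* delta_S_sq X Y is the squared distance \<delta>_S^2(X,Y).  For Hermitian positive definite
   X and Y both determinants are positive reals, so Re only changes the type; X * Y itself
   is in general not Hermitian. *)
definition delta_S_sq :: "complex mat \<Rightarrow> complex mat \<Rightarrow> real" where
  "delta_S_sq X Y =
     ln (Re (det ((1 / 2) \<cdot>\<^sub>m (X + Y)))) - 1 / 2 * ln (Re (det (X * Y)))"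

end

theory Submission
  imports Defs "Jordan_Normal_Form.Spectral_Radius" "HOL-Analysis.Convex"
begin

text \<open>Since log det(A^t B^t) = t log det(AB), only the mean determinants have to be compared.
  Diagonalise A = U diag(d) U^* and B = V diag(e) V^* and apply the Cauchy--Binet formula to
  [U V] diag(d^t, e^t) [U V]^*: the determinant of (A^t + B^t)/2 is a sum of terms c_f x_f^t, where
  c_f \<ge> 0 and x_f > 0 do not depend on t. At t = 0 it equals 1, so the c_f are the weights of a mean,
  and Jensen's inequality for x^t compares the mean of the x_f^t with the t-th power of the mean
  of the x_f, which is det((A + B)/2)^t.\<close>

subsection \<open>Weighted Gram determinants\<close>

text \<open>Cauchy--Binet, summed over all maps f instead of n-subsets; each subset is then hit by its
  n! enumerations, which accounts for the factor on the left.\<close>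

lemma fact_mult_det_weighted_gram:
  fixes w :: "nat \<Rightarrow> 'k \<Rightarrow> complex" and c :: "'k \<Rightarrow> complex"
  assumes K: "finite K"
  shows "fact n * det (mat n n (\<lambda>(i,j). \<Sum>k\<in>K. c k * w i k * cnj (w j k))) =
    (\<Sum>f\<in>PiE {0..<n} (\<lambda>_. K). (\<Prod>i=0..<n. c (f i)) *
      of_real ((cmod (det (mat n n (\<lambda>(i,j). w i (f j)))))\<^sup>2))"
proof -
  define P where "P = {p. p permutes {0..<n}}"
  define G where "G = mat n n (\<lambda>(i,j). \<Sum>k\<in>K. c k * w i k * cnj (w j k))"
  define D where "D f = det (mat n n (\<lambda>(i,j). w i (f j)))" for f
  have G: "G \<in> carrier_mat n n" by (simp add: G_def)
  have range: "p i < n" if "p \<in> P" "i \<in> {0..<n}" for p i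
    using that permutes_in_image[of p "{0..<n}" i] by (auto simp: P_def)
  \<comment> \<open>The Leibniz formula with the permutation on the row index: the column choice
    \<open>f\<close> stays fixed, so products for different permutations can later be collected
    under the same \<open>f\<close>.\<close>
  have D: "D f = (\<Sum>p\<in>P. signof p * (\<Prod>i=0..<n. w (p i) (f i)))" for f
    unfolding D_def P_def
    by (subst mat_det_left_def[of _ n]) (auto intro!: sum.cong prod.cong simp: range[unfolded P_def])
  have cD: "cnj (D f) = (\<Sum>p\<in>P. signof p * (\<Prod>i=0..<n. cnj (w (p i) (f i))))" for f
    unfolding D by simp
  \<comment> \<open>Expanding \<open>det G\<close> after permuting its rows by an arbitrary
    \<open>q\<close> makes the formula symmetric in \<open>p\<close> and \<open>q\<close>. Summing
    over all \<open>q\<close> produces the factor \<open>fact n\<close> and a double sum that can be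
    factored.\<close>
  have row_perm: "det G = signof q * (\<Sum>p\<in>P. signof p * (\<Prod>i=0..<n. G $$ (q i, p i)))"
    if q: "q \<in> P" for q
  proof -
    have "det (mat n n (\<lambda>(i,j). G $$ (q i, j))) = signof q * det G"
      using det_permute_rows[OF G] q by (simp add: P_def)
    moreover have "det (mat n n (\<lambda>(i,j). G $$ (q i, j))) =
        (\<Sum>p\<in>P. signof p * (\<Prod>i=0..<n. G $$ (q i, p i)))"
      unfolding P_def
      by (subst det_def'[of _ n]) (auto intro!: sum.cong prod.cong simp: range[unfolded P_def])
    moreover have "signof q * signof q = (1::complex)" by (simp flip: of_int_mult)
    ultimately show ?thesis by (simp flip: mult.assoc)
  qed
  have entry: "(\<Prod>i=0..<n. G $$ (q i, p i)) =
      (\<Sum>f\<in>PiE {0..<n} (\<lambda>_. K). (\<Prod>i=0..<n. c (f i)) *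
        (\<Prod>i=0..<n. w (q i) (f i)) * (\<Prod>i=0..<n. cnj (w (p i) (f i))))"
    if "p \<in> P" "q \<in> P" for p q
  proof -
    have "(\<Prod>i=0..<n. G $$ (q i, p i)) =
        (\<Prod>i=0..<n. \<Sum>k\<in>K. c k * w (q i) k * cnj (w (p i) k))"
      using that by (intro prod.cong) (auto simp: G_def range)
    then show ?thesis using K by (simp add: prod_sum_PiE prod.distrib)
  qed
  have "fact n * det G = (\<Sum>q\<in>P. det G)"
    by (simp add: P_def card_permutations)
  also have "\<dots> = (\<Sum>q\<in>P. \<Sum>p\<in>P. \<Sum>f\<in>PiE {0..<n} (\<lambda>_. K). (\<Prod>i=0..<n. c (f i)) *
      ((signof q * (\<Prod>i=0..<n. w (q i) (f i))) *
       (signof p * (\<Prod>i=0..<n. cnj (w (p i) (f i))))))"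
    by (rule sum.cong, rule refl, subst row_perm, assumption)
       (auto simp: entry sum_distrib_left mult_ac intro!: sum.cong)
  also have "\<dots> = (\<Sum>f\<in>PiE {0..<n} (\<lambda>_. K). \<Sum>q\<in>P. \<Sum>p\<in>P. (\<Prod>i=0..<n. c (f i)) *
      ((signof q * (\<Prod>i=0..<n. w (q i) (f i))) *
       (signof p * (\<Prod>i=0..<n. cnj (w (p i) (f i))))))"
    by (subst sum.swap[of _ _ "PiE {0..<n} (\<lambda>_. K)"], subst sum.swap, rule refl)
  \<comment> \<open>For fixed \<open>f\<close> the double sum over \<open>q\<close> and
    \<open>p\<close> is a product of two Leibniz expansions.\<close>
  also have "\<dots> = (\<Sum>f\<in>PiE {0..<n} (\<lambda>_. K). (\<Prod>i=0..<n. c (f i)) * (D f * cnj (D f)))"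
    by (intro sum.cong refl, subst cD, subst D) (simp only: sum_product, simp only: sum_distrib_left)
  finally show ?thesis
    by (simp only: G_def D_def complex_norm_square)
qed

subsection \<open>Jensen's inequality for powers\<close>

text \<open>The graph of a concave power lies below its tangent at 1; this is Young's inequality for
  \<open>y\<close> and 1 with weights \<open>t\<close> and \<open>1 - t\<close>.\<close>

lemma powr_le_tangent:
  fixes y t :: real
  assumes "0 < y" "0 \<le> t" "t \<le> 1"
  shows "y powr t \<le> 1 + t * (y - 1)"
  using Youngs_inequality_0[of t "1 - t" y 1] assms by (simp add: algebra_simps)

text \<open>The concave case for the exponent \<open>1 / t\<close> at the point
  \<open>y powr t\<close> reads y \<le> 1 + (y^t - 1) / t; solving for y^t gives the claim.\<close>

lemma powr_ge_tangent:
  fixes y t :: real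
  assumes "0 < y" "1 \<le> t"
  shows "1 + t * (y - 1) \<le> y powr t"
  using powr_le_tangent[of "y powr t" "1 / t"] assms by (simp add: powr_powr field_simps)

text \<open>Dividing by the mean \<open>m\<close> moves the mean to 1, where the tangent bounds
  apply. The weighted mean of the tangent values is exactly 1, because the linear terms
  cancel.\<close>

lemma
  fixes c x :: "'a \<Rightarrow> real"
  assumes nonneg: "\<forall>i\<in>I. 0 \<le> c i" and c1: "sum c I = 1" and pos: "\<forall>i\<in>I. 0 < x i"
  shows weighted_mean_pos: "0 < (\<Sum>i\<in>I. c i * x i)"
    and weighted_mean_powr_le: "0 \<le> t \<Longrightarrow> t \<le> 1 \<Longrightarrow>
      (\<Sum>i\<in>I. c i * x i powr t) \<le> (\<Sum>i\<in>I. c i * x i) powr t"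
    and weighted_mean_powr_ge: "1 \<le> t \<Longrightarrow>
      (\<Sum>i\<in>I. c i * x i) powr t \<le> (\<Sum>i\<in>I. c i * x i powr t)"
proof -
  note c = bspec[OF nonneg] and x = bspec[OF pos]
  define m where "m = (\<Sum>i\<in>I. c i * x i)"
  have I: "finite I" using c1 by (cases "finite I") auto
  \<comment> \<open>Weights with sum 1 cannot all vanish, and a single positive term already bounds
    \<open>m\<close> away from 0.\<close>
  obtain i where i: "i \<in> I" "c i \<noteq> 0"
    using c1 by (metis sum.neutral zero_neq_one)
  then have "0 < c i * x i" using c[of i] x[of i] by simp
  also have "c i * x i \<le> m"
    unfolding m_def
  proof (rule member_le_sum[OF i(1) _ I])
    show "0 \<le> c j * x j" if "j \<in> I - {i}" for j
      using c[of j] x[of j] that by simp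
  qed
  finally have m: "0 < m" .
  then show "0 < (\<Sum>i\<in>I. c i * x i)" by (simp add: m_def)
  have tangent: "(\<Sum>i\<in>I. c i * (1 + t * (x i / m - 1))) = 1"
  proof -
    have "(\<Sum>i\<in>I. c i * (1 + t * (x i / m - 1))) =
        (\<Sum>i\<in>I. (1 - t) * c i + t / m * (c i * x i))"
      by (intro sum.cong refl) (simp add: algebra_simps)
    also have "\<dots> = (1 - t) * sum c I + t / m * m"
      by (simp only: sum.distrib sum_distrib_left m_def)
    finally show ?thesis using m c1 by simp
  qed
  have scale: "(\<Sum>i\<in>I. c i * x i powr t) = m powr t * (\<Sum>i\<in>I. c i * (x i / m) powr t)"
    unfolding sum_distrib_left
  proof (rule sum.cong[OF refl])
    fix i assume "i \<in> I"
    then show "c i * x i powr t = m powr t * (c i * (x i / m) powr t)"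
      using \<open>0 < m\<close> x[of i] by (simp add: powr_divide)
  qed
  show "(\<Sum>i\<in>I. c i * x i powr t) \<le> (\<Sum>i\<in>I. c i * x i) powr t" if "0 \<le> t" "t \<le> 1"
  proof -
    have "(\<Sum>i\<in>I. c i * (x i / m) powr t) \<le> (\<Sum>i\<in>I. c i * (1 + t * (x i / m - 1)))"
      using m x c that by (intro sum_mono mult_left_mono powr_le_tangent divide_pos_pos)
    then show ?thesis unfolding scale tangent by (simp add: m_def mult_left_le)
  qed
  show "(\<Sum>i\<in>I. c i * x i) powr t \<le> (\<Sum>i\<in>I. c i * x i powr t)" if "1 \<le> t"
  proof -
    have "(\<Sum>i\<in>I. c i * (1 + t * (x i / m - 1))) \<le> (\<Sum>i\<in>I. c i * (x i / m) powr t)"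
      using m x c that by (intro sum_mono mult_left_mono powr_ge_tangent divide_pos_pos)
    then have "m powr t * 1 \<le> m powr t * (\<Sum>i\<in>I. c i * (x i / m) powr t)"
      unfolding tangent by (intro mult_left_mono) auto
    then show ?thesis unfolding scale by (simp add: m_def)
  qed
qed

subsection \<open>Spectral theorem\<close>

lemma adjoint_index [simp]:
  "i < dim_col A \<Longrightarrow> j < dim_row A \<Longrightarrow> mat_adjoint A $$ (i, j) = conjugate (A $$ (j, i))"
  by (simp add: mat_adjoint_def mat_of_rows_index)

lemma adjoint_dim [simp]:
  "dim_row (mat_adjoint A) = dim_col A" "dim_col (mat_adjoint A) = dim_row A"
  by (simp_all add: mat_adjoint_def)

lemma adjoint_carrier [simp]: "A \<in> carrier_mat n m \<Longrightarrow> mat_adjoint A \<in> carrier_mat m n"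
  by (intro carrier_matI) simp_all

lemma adjoint_mult_index:
  fixes A B :: "complex mat"
  assumes "A \<in> carrier_mat k n" "B \<in> carrier_mat k m" "i < n" "j < m"
  shows "(mat_adjoint A * B) $$ (i, j) = (\<Sum>l<k. cnj (A $$ (l, i)) * B $$ (l, j))"
  using assms by (auto simp: scalar_prod_def atLeast0LessThan)

lemma unitary_matI:
  assumes U: "U \<in> carrier_mat n n" and "mat_adjoint U * U = 1\<^sub>m n"
  shows "unitary_mat U"
  using mat_mult_left_right_inverse[OF adjoint_carrier[OF U] U] assms
  by (auto simp: unitary_mat_def)

text \<open>This sum has the shape of the weighted Gram entries in
  \<open>fact_mult_det_weighted_gram\<close>, with the columns of \<open>U\<close> as index
  set.\<close>

lemma mult_diag_adjoint_index:
  assumes U: "U \<in> carrier_mat n n" and "i < n" "j < n"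
  shows "(U * mat_diag n f * mat_adjoint U) $$ (i, j) = (\<Sum>k<n. f k * U $$ (i, k) * cnj (U $$ (j, k)))"
  unfolding mat_diag_mult_right[OF U]
  using assms by (auto simp: scalar_prod_def mult_ac atLeast0LessThan intro!: sum.cong)

lemma mult_diag_adjoint_carrier:
  "U \<in> carrier_mat n n \<Longrightarrow> U * mat_diag n f * mat_adjoint U \<in> carrier_mat n n"
  by (auto intro!: carrier_matI)

text \<open>Complete \<open>v\<close> to a basis and orthogonalise: Gram-Schmidt leaves the first
  vector unchanged. It does not normalise, so the columns are rescaled afterwards, which is where
  the factor \<open>a\<close> comes from.\<close>

lemma unitary_with_first_column:
  fixes v :: "complex vec"
  assumes v: "v \<in> carrier_vec n" and v0: "v \<noteq> 0\<^sub>v n"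
  shows "\<exists>W a. W \<in> carrier_mat n n \<and> mat_adjoint W * W = 1\<^sub>m n \<and> (\<forall>i<n. W $$ (i, 0) = a * v $ i)"
proof -
  have n: "n \<noteq> 0" using v v0 by auto
  interpret cof_vec_space n "TYPE(complex)" .
  define b where "b = basis_completion v"
  define ws where "ws = gram_schmidt n b"
  from basis_completion[OF v v0, folded b_def]
  have dist_b: "distinct b" and indep: "\<not> lin_dep (set b)" and b: "set b \<subseteq> carrier_vec n"
    and hdb: "hd b = v" and len_b: "length b = n" by auto
  from hdb len_b n obtain vs where bv: "b = v # vs" by (cases b) auto
  from gram_schmidt_result[OF b dist_b indep refl, folded ws_def]
  have ws: "set ws \<subseteq> carrier_vec n" and orth: "corthogonal ws" and len: "length ws = n"
    by (auto simp: len_b)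
  from gram_schmidt_hd[OF v, of vs, folded bv] have hdws: "ws ! 0 = v"
    unfolding ws_def[symmetric] using len n by (cases ws) auto
  have wsc: "ws ! j \<in> carrier_vec n" if "j < n" for j using ws len that by (metis nth_mem subsetD)
  define s where "s j = (\<Sum>k<n. (cmod (ws ! j $ k))\<^sup>2)" for j
  have inner: "(\<Sum>k<n. cnj (ws ! i $ k) * ws ! j $ k) = ws ! j \<bullet>c ws ! i" if "i < n" "j < n" for i j
    using wsc[OF that(1)] wsc[OF that(2)] by (auto simp: scalar_prod_def atLeast0LessThan mult.commute)
  have s: "of_real (s j) = ws ! j \<bullet>c ws ! j" if "j < n" for j
    unfolding inner[OF that that, symmetric] s_def of_real_sum complex_norm_square
    by (simp add: mult.commute)
  \<comment> \<open>\<open>corthogonal\<close> also says that no vector of the list is orthogonal to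
    itself, so the squared norms are nonzero.\<close>
  have spos: "0 < s j" if "j < n" for j
  proof -
    have "s j \<noteq> 0" using s[OF that] corthogonalD[OF orth, of j j] that len by auto
    moreover have "0 \<le> s j" by (simp add: s_def sum_nonneg)
    ultimately show ?thesis by simp
  qed
  define W where "W = mat n n (\<lambda>(i,j). ws ! j $ i / of_real (sqrt (s j)))"
  have W: "W \<in> carrier_mat n n" by (simp add: W_def)
  have "mat_adjoint W * W = 1\<^sub>m n"
  proof (rule eq_matI)
    fix i j assume "i < dim_row (1\<^sub>m n :: complex mat)" "j < dim_col (1\<^sub>m n :: complex mat)"
    then have ij: "i < n" "j < n" by auto
    have "(mat_adjoint W * W) $$ (i, j) =
        (\<Sum>k<n. cnj (ws ! i $ k) * ws ! j $ k / (of_real (sqrt (s i)) * of_real (sqrt (s j))))"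
      unfolding adjoint_mult_index[OF W W ij] using ij by (intro sum.cong) (auto simp: W_def)
    also have "\<dots> = ws ! j \<bullet>c ws ! i / (of_real (sqrt (s i)) * of_real (sqrt (s j)))"
      unfolding inner[OF ij, symmetric] by (simp add: sum_divide_distrib)
    also have "\<dots> = 1\<^sub>m n $$ (i, j)"
    proof (cases "i = j")
      case True
      then show ?thesis
        using ij spos[OF ij(2)] by (simp add: s[OF ij(2), symmetric] flip: of_real_mult)
    next
      case False
      then show ?thesis using corthogonalD[OF orth, of j i] ij len by auto
    qed
    finally show "(mat_adjoint W * W) $$ (i, j) = 1\<^sub>m n $$ (i, j)" .
  qed (use W in auto)
  moreover have "\<forall>i<n. W $$ (i, 0) = (1 / of_real (sqrt (s 0))) * v $ i"
    using n by (auto simp: W_def hdws)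
  ultimately show ?thesis using W by blast
qed

lemma complex_eigenvector_exists:
  fixes A :: "complex mat"
  assumes A: "A \<in> carrier_mat n n" and "n > 0"
  obtains v e where "v \<in> carrier_vec n" "v \<noteq> 0\<^sub>v n" "A *\<^sub>v v = e \<cdot>\<^sub>v v"
  using spectrum_non_empty[OF assms] A unfolding spectrum_def eigenvalue_def eigenvector_def by auto

text \<open>Deflation: in an orthonormal basis starting with an eigenvector, the first column of the
  matrix vanishes below the diagonal. By Hermitian symmetry so does the rest of the first row, and
  the remaining block is Hermitian of size one less.\<close>

lemma hermitian_spectral:
  assumes "A \<in> carrier_mat n n" "mat_adjoint A = A"
  shows "\<exists>U d. U \<in> carrier_mat n n \<and> mat_adjoint U * U = 1\<^sub>m n \<and>
     A = U * mat_diag n (\<lambda>i. complex_of_real (d i)) * mat_adjoint U"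
  using assms
proof (induction n arbitrary: A)
  case 0
  then show ?case by (intro exI[of _ A]) (auto intro!: eq_matI)
next
  case (Suc n)
  note A = Suc.prems(1)
  obtain v e where v: "v \<in> carrier_vec (Suc n)" "v \<noteq> 0\<^sub>v (Suc n)" and ev: "A *\<^sub>v v = e \<cdot>\<^sub>v v"
    using complex_eigenvector_exists[OF A] by auto
  obtain W a where W: "W \<in> carrier_mat (Suc n) (Suc n)" and WW: "mat_adjoint W * W = 1\<^sub>m (Suc n)"
    and W0: "\<And>i. i < Suc n \<Longrightarrow> W $$ (i, 0) = a * v $ i"
    using unitary_with_first_column[OF v] by blast
  have WW': "W * mat_adjoint W = 1\<^sub>m (Suc n)"
    using mat_mult_left_right_inverse[OF adjoint_carrier[OF W] W WW] .
  define B where "B = mat_adjoint W * (A * W)"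
  have B: "B \<in> carrier_mat (Suc n) (Suc n)" using A W by (auto simp: B_def intro!: carrier_matI)
  have AW0: "(A * W) $$ (i, 0) = e * W $$ (i, 0)" if i: "i < Suc n" for i
  proof -
    have "(A * W) $$ (i, 0) = (\<Sum>k<Suc n. A $$ (i, k) * (a * v $ k))"
      using A W i by (auto simp: scalar_prod_def atLeast0LessThan W0 simp del: sum.lessThan_Suc intro!: sum.cong)
    also have "\<dots> = a * (A *\<^sub>v v) $ i"
      using A v i by (auto simp: scalar_prod_def atLeast0LessThan sum_distrib_left mult_ac
        simp del: sum.lessThan_Suc intro!: sum.cong)
    also have "\<dots> = e * W $$ (i, 0)" using i v by (simp add: ev W0)
    finally show ?thesis .
  qed
  \<comment> \<open>Column 0 of \<open>A * W\<close> is \<open>e\<close> times column 0 of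
    \<open>W\<close>, so column 0 of \<open>B\<close> is \<open>e\<close> times that of the
    identity.\<close>
  have B0: "B $$ (i, 0) = (if i = 0 then e else 0)" if i: "i < Suc n" for i
  proof -
    have "B $$ (i, 0) = e * (mat_adjoint W * W) $$ (i, 0)"
      unfolding B_def using A W i
      by (subst (1 2) adjoint_mult_index[of _ "Suc n" "Suc n" _ "Suc n"])
         (auto simp: AW0 sum_distrib_left mult_ac simp del: sum.lessThan_Suc index_mult_mat intro!: sum.cong)
    then show ?thesis using i by (simp add: WW)
  qed
  have A_index: "A $$ (i, j) = cnj (A $$ (j, i))" if "i < Suc n" "j < Suc n" for i j
    by (subst Suc.prems(2)[symmetric]) (use that A in auto)
  have B_index: "B $$ (i, j) = cnj (B $$ (j, i))" if ij: "i < Suc n" "j < Suc n" for i j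
  proof -
    have ex: "B $$ (i, j) = (\<Sum>k<Suc n. \<Sum>l<Suc n. cnj (W $$ (k, i)) * (A $$ (k, l) * W $$ (l, j)))"
      if ij: "i < Suc n" "j < Suc n" for i j
      unfolding B_def using A W ij
      by (subst adjoint_mult_index[of _ "Suc n" "Suc n" _ "Suc n"])
         (auto simp: scalar_prod_def atLeast0LessThan sum_distrib_left simp del: sum.lessThan_Suc intro!: sum.cong)
    show ?thesis
      unfolding ex[OF ij] ex[OF ij(2,1)] cnj_sum
    proof (subst sum.swap, intro sum.cong refl)
      fix k l assume "l \<in> {..<Suc n}" "k \<in> {..<Suc n}"
      then show "cnj (W $$ (l, i)) * (A $$ (l, k) * W $$ (k, j)) =
          cnj (cnj (W $$ (k, j)) * (A $$ (k, l) * W $$ (l, i)))"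
        using A_index[of l k] by (simp add: mult_ac)
    qed
  qed
  have B0': "B $$ (0, Suc j) = 0" if "j < n" for j
    using B_index[of 0 "Suc j"] B0[of "Suc j"] that by simp
  define C where "C = mat n n (\<lambda>(i,j). B $$ (Suc i, Suc j))"
  have C: "C \<in> carrier_mat n n" by (simp add: C_def)
  have "mat_adjoint C = C"
    by (rule eq_matI) (auto simp: C_def B_index[symmetric])
  from Suc.IH[OF C this] obtain U d where U: "U \<in> carrier_mat n n" and UU: "mat_adjoint U * U = 1\<^sub>m n"
    and CU: "C = U * mat_diag n (\<lambda>i. complex_of_real (d i)) * mat_adjoint U" by blast
  \<comment> \<open>The block diagonal matrix with blocks 1 and \<open>U\<close>; \<open>g\<close>
    correspondingly puts the eigenvalue \<open>e\<close> in front of \<open>d\<close>.\<close>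
  define V where "V = mat (Suc n) (Suc n) (\<lambda>(i,j). case (i, j) of (0, 0) \<Rightarrow> 1
    | (Suc i', Suc j') \<Rightarrow> U $$ (i', j') | _ \<Rightarrow> 0)"
  define g where "g = case_nat (Re e) d"
  have V: "V \<in> carrier_mat (Suc n) (Suc n)" by (simp add: V_def)
  have V_index: "V $$ (0, 0) = 1" "k < n \<Longrightarrow> V $$ (0, Suc k) = 0" "k < n \<Longrightarrow> V $$ (Suc k, 0) = 0"
    "k < n \<Longrightarrow> l < n \<Longrightarrow> V $$ (Suc k, Suc l) = U $$ (k, l)" for k l
    by (simp_all add: V_def)
  \<comment> \<open>\<open>e\<close> is a diagonal entry of the Hermitian matrix \<open>B\<close>,
    hence real.\<close>
  have e: "complex_of_real (Re e) = e"
    using B_index[of 0 0] B0[of 0] by (simp add: complex_eq_iff)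
  have VV: "mat_adjoint V * V = 1\<^sub>m (Suc n)"
  proof (rule eq_matI)
    fix i j assume "i < dim_row (1\<^sub>m (Suc n) :: complex mat)" "j < dim_col (1\<^sub>m (Suc n) :: complex mat)"
    then have ij: "i < Suc n" "j < Suc n" by auto
    show "(mat_adjoint V * V) $$ (i, j) = 1\<^sub>m (Suc n) $$ (i, j)"
    proof (cases i; cases j)
      fix i' j' assume eq: "i = Suc i'" "j = Suc j'"
      have "(mat_adjoint V * V) $$ (i, j) = (mat_adjoint U * U) $$ (i', j')"
        unfolding adjoint_mult_index[OF V V ij] sum.lessThan_Suc_shift
        using ij eq by (subst adjoint_mult_index[OF U U]) (auto simp: V_index)
      then show ?thesis using ij eq by (simp add: UU)
    qed (use ij in \<open>auto simp: adjoint_mult_index[OF V V] sum.lessThan_Suc_shift V_index simp del: index_mult_mat sum.lessThan_Suc\<close>)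
  qed (use V in auto)
  have BV: "B = V * mat_diag (Suc n) (\<lambda>i. complex_of_real (g i)) * mat_adjoint V"
  proof (rule eq_matI)
    fix i j assume "i < dim_row (V * mat_diag (Suc n) (\<lambda>i. complex_of_real (g i)) * mat_adjoint V)"
      "j < dim_col (V * mat_diag (Suc n) (\<lambda>i. complex_of_real (g i)) * mat_adjoint V)"
    then have ij: "i < Suc n" "j < Suc n" using V by auto
    show "B $$ (i, j) = (V * mat_diag (Suc n) (\<lambda>i. complex_of_real (g i)) * mat_adjoint V) $$ (i, j)"
    proof (cases i; cases j)
      fix i' j' assume eq: "i = Suc i'" "j = Suc j'"
      have "B $$ (i, j) = C $$ (i', j')" using eq ij by (simp add: C_def)
      then show ?thesis
        unfolding CU mult_diag_adjoint_index[OF V ij] sum.lessThan_Suc_shift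
        using ij eq by (subst (asm) mult_diag_adjoint_index[OF U]) (auto simp: V_index g_def)
    qed (use ij in \<open>auto simp: mult_diag_adjoint_index[OF V] sum.lessThan_Suc_shift V_index g_def B0 B0' e simp del: index_mult_mat sum.lessThan_Suc\<close>)
  qed (use B V in auto)
  define X where "X = W * V"
  have X: "X \<in> carrier_mat (Suc n) (Suc n)" using W V by (auto simp: X_def intro!: carrier_matI)
  have adjX: "mat_adjoint X = mat_adjoint V * mat_adjoint W"
    using W V by (intro eq_matI) (auto simp: X_def scalar_prod_def mult.commute)
  note [simp] = W V A mult_carrier_mat[of _ "Suc n" "Suc n" _ "Suc n"]
  have XX: "mat_adjoint X * X = 1\<^sub>m (Suc n)"
  proof -
    have "mat_adjoint X * X = mat_adjoint V * ((mat_adjoint W * W) * V)"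
      unfolding adjX unfolding X_def by (simp add: assoc_mult_mat[of _ "Suc n" "Suc n" _ "Suc n" _ "Suc n"])
    then show ?thesis by (simp only: WW VV left_mult_one_mat[OF V])
  qed
  have "A = (W * mat_adjoint W) * A * (W * mat_adjoint W)" by (simp only: WW' left_mult_one_mat[OF A] right_mult_one_mat[OF A])
  also have "\<dots> = W * B * mat_adjoint W"
    unfolding B_def by (simp add: assoc_mult_mat[of _ "Suc n" "Suc n" _ "Suc n" _ "Suc n"])
  also have "\<dots> = X * mat_diag (Suc n) (\<lambda>i. complex_of_real (g i)) * mat_adjoint X"
    unfolding BV adjX unfolding X_def by (simp add: assoc_mult_mat[of _ "Suc n" "Suc n" _ "Suc n" _ "Suc n"])
  finally show ?case using X XX by blast
qed

subsection \<open>Powers and determinants\<close>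

abbreviation unitary_diag :: "complex mat \<Rightarrow> nat \<Rightarrow> (nat \<Rightarrow> real) \<Rightarrow> complex mat" where
  "unitary_diag U n d \<equiv> U * mat_diag n (\<lambda>i. complex_of_real (d i)) * mat_adjoint U"

text \<open>Column \<open>i\<close> of \<open>U\<close> is a unit eigenvector for
  \<open>d i\<close>, so the quadratic form of \<open>A\<close> takes the value \<open>d i\<close>
  there.\<close>

lemma pos_def_eigenvalue_pos:
  assumes A: "A = unitary_diag U n d" and U: "U \<in> carrier_mat n n" and UU: "mat_adjoint U * U = 1\<^sub>m n"
    and pd: "hermitian_pos_def A" and i: "i < n"
  shows "0 < d i"
proof -
  define u where "u = col U i"
  have u: "u \<in> carrier_vec n" using U by (simp add: u_def carrier_vecI)
  have Ac: "A \<in> carrier_mat n n" unfolding A by (rule mult_diag_adjoint_carrier[OF U])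
  have "A * U = U * mat_diag n (\<lambda>i. complex_of_real (d i)) * (mat_adjoint U * U)"
    unfolding A by (rule assoc_mult_mat[of _ n n _ n _ n]) (use U in \<open>auto intro!: carrier_matI\<close>)
  also have "\<dots> = mat n n (\<lambda>(i, j). U $$ (i, j) * of_real (d j))"
    unfolding UU mat_diag_mult_right[OF U] by (rule right_mult_one_mat[of _ n]) simp
  finally have AU: "A * U = mat n n (\<lambda>(i, j). U $$ (i, j) * of_real (d j))" .
  have "A *\<^sub>v u = col (A * U) i"
    using Ac U i by (auto simp: u_def)
  also have "\<dots> = of_real (d i) \<cdot>\<^sub>v u"
    unfolding AU using U i by (intro eq_vecI) (auto simp: u_def mult.commute)
  finally have Au: "A *\<^sub>v u = of_real (d i) \<cdot>\<^sub>v u" .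
  have "u \<bullet>c u = (mat_adjoint U * U) $$ (i, i)"
    unfolding adjoint_mult_index[OF U U i i] using U i
    by (auto simp: u_def scalar_prod_def atLeast0LessThan mult.commute intro!: sum.cong)
  then have uu: "u \<bullet>c u = 1" using i by (simp add: UU)
  then have "u \<noteq> 0\<^sub>v n" by auto
  then have "0 < Re ((A *\<^sub>v u) \<bullet>c u)" using pd u Ac by (auto simp: hermitian_pos_def_def)
  then show ?thesis using u by (simp add: Au uu)
qed

lemma pos_def_spectral:
  assumes A: "A \<in> carrier_mat n n" and pd: "hermitian_pos_def A"
  shows "\<exists>U d. U \<in> carrier_mat n n \<and> mat_adjoint U * U = 1\<^sub>m n \<and>
    A = unitary_diag U n d \<and> (\<forall>i<n. 0 < d i)"
  using hermitian_spectral[OF A] pos_def_eigenvalue_pos[OF _ _ _ pd] pd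
  unfolding hermitian_pos_def_def hermitian_mat_def by blast

text \<open>The entries of M = V^* U satisfy e i * M i j = M i j * d j, so M i j vanishes unless
  d j = e i, and then M also intertwines the images of the two diagonals under g.\<close>

lemma unitary_diag_fun_cong:
  fixes d e g
  assumes U: "U \<in> carrier_mat n n" and UU: "mat_adjoint U * U = 1\<^sub>m n"
    and V: "V \<in> carrier_mat n n" and VV: "mat_adjoint V * V = 1\<^sub>m n"
    and eq: "unitary_diag U n d = unitary_diag V n e"
  shows "unitary_diag U n (\<lambda>i. g (d i)) = unitary_diag V n (\<lambda>i. g (e i))"
proof -
  note [simp] = U V mult_carrier_mat[of _ n n _ n] adjoint_carrier[of _ n n]
    left_mult_one_mat[of _ n n] right_mult_one_mat[of _ n n]
  note assoc = assoc_mult_mat[of _ n n _ n _ n]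
  have UU': "U * mat_adjoint U = 1\<^sub>m n" and VV': "V * mat_adjoint V = 1\<^sub>m n"
    using mat_mult_left_right_inverse[OF adjoint_carrier[OF U] U UU]
      mat_mult_left_right_inverse[OF adjoint_carrier[OF V] V VV] .
  define M where "M = mat_adjoint V * U"
  have M: "M \<in> carrier_mat n n" by (simp add: M_def)
  have "M * mat_diag n (\<lambda>i. complex_of_real (d i)) = mat_adjoint V * (unitary_diag U n d * U)"
    unfolding M_def by (simp add: assoc UU)
  also have "\<dots> = (mat_adjoint V * V) * mat_diag n (\<lambda>i. complex_of_real (e i)) * (mat_adjoint V * U)"
    unfolding eq by (simp add: assoc)
  also have "\<dots> = mat_diag n (\<lambda>i. complex_of_real (e i)) * M"
    unfolding VV M_def by simp
  finally have inter: "M * mat_diag n (\<lambda>i. complex_of_real (d i)) = mat_diag n (\<lambda>i. complex_of_real (e i)) * M" .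
  have entry: "M $$ (i, j) = 0 \<or> d j = e i" if "i < n" "j < n" for i j
    using arg_cong[OF inter, of "\<lambda>X. X $$ (i, j)"] that
    unfolding mat_diag_mult_left[OF M] mat_diag_mult_right[OF M] by auto
  have inter': "M * mat_diag n (\<lambda>i. complex_of_real (g (d i))) = mat_diag n (\<lambda>i. complex_of_real (g (e i))) * M"
    unfolding mat_diag_mult_left[OF M] mat_diag_mult_right[OF M]
    by (rule eq_matI) (use entry in fastforce)+
  have "unitary_diag U n (\<lambda>i. g (d i)) = (V * mat_adjoint V) * unitary_diag U n (\<lambda>i. g (d i))"
    unfolding VV' by simp
  also have "\<dots> = V * (M * mat_diag n (\<lambda>i. complex_of_real (g (d i)))) * mat_adjoint U"
    unfolding M_def by (simp add: assoc)
  also have "\<dots> = V * mat_diag n (\<lambda>i. complex_of_real (g (e i))) * mat_adjoint V * (U * mat_adjoint U)"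
    unfolding inter' unfolding M_def by (simp add: assoc)
  also have "\<dots> = unitary_diag V n (\<lambda>i. g (e i))"
    unfolding UU' by simp
  finally show ?thesis .
qed

text \<open>Discharges the definite description in \<open>mat_powr\<close>: the given decomposition
  is a witness, and \<open>unitary_diag_fun_cong\<close> shows that any other one yields the same
  power.\<close>

lemma mat_powr_unitary_diag:
  assumes U: "U \<in> carrier_mat n n" and UU: "mat_adjoint U * U = 1\<^sub>m n"
    and d: "\<forall>i<n. 0 < d i"
  shows "mat_powr (unitary_diag U n d) t = unitary_diag U n (\<lambda>i. d i powr t)"
proof -
  have dim: "dim_row (unitary_diag U n d) = n" using U by simp
  show ?thesis
    unfolding mat_powr_def dim
  proof (rule the_equality)
    show "\<exists>W f. unitary_mat W \<and> dim_row W = n \<and> (\<forall>i<n. 0 < f i) \<and>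
      unitary_diag U n d = unitary_diag W n f \<and>
      unitary_diag U n (\<lambda>i. d i powr t) = unitary_diag W n (\<lambda>i. f i powr t)"
      using unitary_matI[OF U UU] U d by (intro exI[of _ U] exI[of _ d]) auto
  next
    fix B assume "\<exists>W f. unitary_mat W \<and> dim_row W = n \<and> (\<forall>i<n. 0 < f i) \<and>
      unitary_diag U n d = unitary_diag W n f \<and> B = unitary_diag W n (\<lambda>i. f i powr t)"
    then obtain W f where W: "unitary_mat W" "dim_row W = n"
      and eq: "unitary_diag U n d = unitary_diag W n f" and B: "B = unitary_diag W n (\<lambda>i. f i powr t)"
      by blast
    from W have W': "W \<in> carrier_mat n n" "mat_adjoint W * W = 1\<^sub>m n"
      by (auto simp: unitary_mat_def)
    show "B = unitary_diag U n (\<lambda>i. d i powr t)"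
      unfolding B by (rule unitary_diag_fun_cong[OF U UU W' eq, of "\<lambda>x. x powr t", symmetric])
  qed
qed

section \<open>Determinants of powers and of their mean\<close>

lemma det_unitary_diag:
  assumes U: "U \<in> carrier_mat n n" and UU: "mat_adjoint U * U = 1\<^sub>m n"
  shows "det (unitary_diag U n d) = of_real (\<Prod>i<n. d i)"
proof -
  have "det (mat_adjoint U) * det U = det (mat_adjoint U * U)"
    using U by (simp add: det_mult[of _ n])
  then have *: "det (mat_adjoint U) * det U = 1" by (simp add: UU)
  have "det (mat_diag n (\<lambda>i. complex_of_real (d i))) = of_real (\<Prod>i<n. d i)"
    by (subst det_lower_triangular[of n])
       (auto simp: mat_diag_def prod_list_diag_prod atLeast0LessThan)
  then show ?thesis
    using * U by (simp add: det_mult[of _ n] mult_carrier_mat[of _ n n _ n] mult_ac)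
qed

text \<open>The quantifier order is the point: \<open>I\<close>, \<open>c\<close> and
  \<open>x\<close> are chosen before \<open>t\<close>, so one family of weights serves both the
  exponent \<open>t\<close> and the exponent 1.\<close>

lemma det_mean_powr_expansion:
  fixes d e :: "nat \<Rightarrow> real"
  assumes U: "U \<in> carrier_mat n n" and UU: "mat_adjoint U * U = 1\<^sub>m n" and d: "\<forall>i<n. 0 < d i"
    and V: "V \<in> carrier_mat n n" and VV: "mat_adjoint V * V = 1\<^sub>m n" and e: "\<forall>i<n. 0 < e i"
  shows "\<exists>(I :: (nat \<Rightarrow> nat + nat) set) c x. (\<forall>f\<in>I. 0 \<le> c f) \<and> sum c I = 1 \<and> (\<forall>f\<in>I. 0 < x f) \<and>
    (\<forall>t. det ((1 / 2) \<cdot>\<^sub>m (unitary_diag U n (\<lambda>i. d i powr t) + unitary_diag V n (\<lambda>i. e i powr t))) =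
      of_real (\<Sum>f\<in>I. c f * x f powr t))"
proof -
  \<comment> \<open>The columns of the block matrix [U V]: left summands index columns of
    \<open>U\<close>, right summands those of \<open>V\<close>. \<open>l\<close> lists the
    eigenvalues in the same way.\<close>
  define K where "K = {..<n} <+> {..<n}"
  define l where "l = case_sum d e"
  define w where "w i = case_sum (\<lambda>k. U $$ (i, k)) (\<lambda>k. V $$ (i, k))" for i
  define I where "I = PiE {0..<n} (\<lambda>_. K)"
  \<comment> \<open>The factor \<open>(1 / 2) ^ n\<close> collects the halves of the mean,
    \<open>1 / fact n\<close> undoes the summation over maps instead of subsets, and the last factor
    is the squared modulus of a minor of [U V].\<close>
  define c where "c f = (1 / 2) ^ n / fact n * (cmod (det (mat n n (\<lambda>(i,j). w i (f j)))))\<^sup>2" for f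
  define x where "x f = (\<Prod>i=0..<n. l (f i))" for f
  let ?S = "\<lambda>t. (1 / 2) \<cdot>\<^sub>m (unitary_diag U n (\<lambda>i. d i powr t) + unitary_diag V n (\<lambda>i. e i powr t))"
  have l: "0 < l (f i)" if "f \<in> I" "i < n" for f i
    using that d e by (auto simp: I_def K_def l_def PiE_iff dest!: bspec[of _ _ i])
  have K: "finite K" by (simp add: K_def)
  have S: "?S t = mat n n (\<lambda>(i,j). \<Sum>k\<in>K. of_real (1 / 2 * l k powr t) * w i k * cnj (w j k))" for t
  proof (rule eq_matI; (simp only: dim_row_mat dim_col_mat)?)
    fix i j assume ij: "i < n" "j < n"
    have "?S t $$ (i, j) = 1 / 2 * (unitary_diag U n (\<lambda>i. d i powr t) $$ (i, j)
        + unitary_diag V n (\<lambda>i. e i powr t) $$ (i, j))"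
      using U V ij by (simp del: index_mult_mat add: index_mult_mat(2,3))
    also have "\<dots> = (\<Sum>k\<in>K. of_real (1 / 2 * l k powr t) * w i k * cnj (w j k))"
      unfolding mult_diag_adjoint_index[OF U ij] mult_diag_adjoint_index[OF V ij] K_def
      by (subst sum.Plus) (simp_all add: l_def w_def sum_distrib_left distrib_left mult_ac)
    finally show "?S t $$ (i, j) = mat n n (\<lambda>(i,j). \<Sum>k\<in>K. of_real (1 / 2 * l k powr t) * w i k * cnj (w j k)) $$ (i, j)"
      using ij by simp
  qed (use U V in auto)
  have det: "det (?S t) = of_real (\<Sum>f\<in>I. c f * x f powr t)" for t
  proof -
    have "fact n * det (?S t) = (\<Sum>f\<in>I. (\<Prod>i=0..<n. of_real (1 / 2 * l (f i) powr t)) *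
        of_real ((cmod (det (mat n n (\<lambda>(i,j). w i (f j)))))\<^sup>2))"
      unfolding S I_def by (rule fact_mult_det_weighted_gram[OF K])
    also have "\<dots> = (\<Sum>f\<in>I. of_real (fact n * (c f * x f powr t)))"
    proof (rule sum.cong[OF refl])
      fix f assume f: "f \<in> I"
      have "(\<Prod>i=0..<n. 1 / 2 * l (f i) powr t) = (1 / 2) ^ n * x f powr t"
        unfolding prod.distrib x_def using l[OF f]
        by (subst prod_powr_distrib) (auto intro: less_imp_le)
      then show "(\<Prod>i=0..<n. complex_of_real (1 / 2 * l (f i) powr t)) *
          of_real ((cmod (det (mat n n (\<lambda>(i,j). w i (f j)))))\<^sup>2) = of_real (fact n * (c f * x f powr t))"
        unfolding of_real_prod[symmetric] of_real_mult[symmetric] by (simp add: c_def)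
    qed
    also have "\<dots> = fact n * of_real (\<Sum>f\<in>I. c f * x f powr t)"
      by (simp add: sum_distrib_left)
    finally show ?thesis by (simp only: mult_left_cancel[OF fact_nonzero])
  qed
  \<comment> \<open>Positivity matters here, since \<open>0 powr 0\<close> is 0 in Isabelle; the
    same holds for \<open>x f powr 0\<close> below.\<close>
  have one: "W * mat_diag n (\<lambda>i. complex_of_real (h i powr 0)) * mat_adjoint W = 1\<^sub>m n"
    if W: "W \<in> carrier_mat n n" "mat_adjoint W * W = 1\<^sub>m n" and h: "\<forall>i<n. 0 < h i" for W h
  proof -
    have "mat_diag n (\<lambda>i. complex_of_real (h i powr 0)) = 1\<^sub>m n"
      using h by (intro eq_matI) (force simp: mat_diag_def)+
    then show ?thesis
      using mat_mult_left_right_inverse[OF adjoint_carrier[OF W(1)] W] W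
      by (simp add: right_mult_one_mat[of _ n n])
  qed
  have "?S 0 = 1\<^sub>m n"
    unfolding one[OF U UU d] one[OF V VV e] by (rule eq_matI) auto
  then have "complex_of_real (\<Sum>f\<in>I. c f * x f powr 0) = 1"
    using det[of 0] by simp
  moreover have pos: "0 < x f" if "f \<in> I" for f
    unfolding x_def using l[OF that] by (intro prod_pos) auto
  ultimately have "sum c I = 1"
    by (simp add: less_imp_neq[symmetric] cong: sum.cong flip: of_real_sum)
  moreover have "0 \<le> c f" for f by (simp add: c_def)
  ultimately show ?thesis using pos det by blast
qed

theorem theorem4p5:
  fixes A B :: "complex mat" and n :: nat and t :: real
  assumes "A \<in> carrier_mat n n" and "B \<in> carrier_mat n n"
    and "hermitian_pos_def A" and "hermitian_pos_def B"
  shows "(0 \<le> t \<and> t \<le> 1 \<longrightarrow>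
            delta_S_sq (mat_powr A t) (mat_powr B t) \<le> t * delta_S_sq A B) \<and>
         (1 \<le> t \<longrightarrow>
            delta_S_sq (mat_powr A t) (mat_powr B t) \<ge> t * delta_S_sq A B)"
proof -
  obtain U d where
    U: "U \<in> carrier_mat n n" "mat_adjoint U * U = 1\<^sub>m n" and A: "A = unitary_diag U n d"
    and d: "\<forall>i<n. 0 < d i" using pos_def_spectral[OF assms(1,3)] by (elim exE conjE) (rule that)
  obtain V e where
    V: "V \<in> carrier_mat n n" "mat_adjoint V * V = 1\<^sub>m n" and B: "B = unitary_diag V n e"
    and e: "\<forall>i<n. 0 < e i" using pos_def_spectral[OF assms(2,4)] by (elim exE conjE) (rule that)
  obtain I :: "(nat \<Rightarrow> nat + nat) set" and c x
    where c: "\<forall>f\<in>I. 0 \<le> c f" and c1: "sum c I = 1" and x: "\<forall>f\<in>I. 0 < x f"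
      and det: "\<forall>t. det ((1 / 2) \<cdot>\<^sub>m (unitary_diag U n (\<lambda>i. d i powr t) + unitary_diag V n (\<lambda>i. e i powr t))) =
        of_real (\<Sum>f\<in>I. c f * x f powr t)"
    using det_mean_powr_expansion[OF U d V e] by (elim exE conjE) (rule that)
  \<comment> \<open>This is det A * det B, and it enters both sides through the same term
    \<open>t / 2 * ln D\<close>.\<close>
  define D where "D = (\<Prod>i<n. d i) * (\<Prod>i<n. e i)"
  define m where "m = (\<Sum>f\<in>I. c f * x f)"
  have D: "0 < D" unfolding D_def using d e by (intro mult_pos_pos prod_pos) auto
  have m: "0 < m" unfolding m_def by (rule weighted_mean_pos[OF c c1 x])
  have powr_eq: "mat_powr A s = unitary_diag U n (\<lambda>i. d i powr s)"
    "mat_powr B s = unitary_diag V n (\<lambda>i. e i powr s)" for s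
    unfolding A B by (rule mat_powr_unitary_diag[OF U d] mat_powr_unitary_diag[OF V e])+
  have delta: "delta_S_sq (mat_powr A s) (mat_powr B s) =
      ln (\<Sum>f\<in>I. c f * x f powr s) - s / 2 * ln D" for s
  proof -
    have "det (mat_powr A s * mat_powr B s) = of_real ((\<Prod>i<n. d i powr s) * (\<Prod>i<n. e i powr s))"
      unfolding powr_eq
      by (subst det_mult[of _ n]) (simp_all add: U V mult_diag_adjoint_carrier det_unitary_diag)
    also have "(\<Prod>i<n. d i powr s) * (\<Prod>i<n. e i powr s) = D powr s"
      unfolding D_def using d e
      by (subst powr_mult) (auto simp: prod_powr_distrib less_imp_le intro!: prod_nonneg)
    finally show ?thesis
      using D unfolding delta_S_sq_def by (simp add: powr_eq det[rule_format] ln_powr del: det_smult)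
  qed
  \<comment> \<open>With this, \<open>delta\<close> at exponent 1 describes
    \<open>delta_S_sq A B\<close> by the same weights as at exponent \<open>t\<close>.\<close>
  have mat_powr_one: "mat_powr A 1 = A" "mat_powr B 1 = B"
    unfolding powr_eq unfolding A B using U V d e
    by (auto simp: mat_diag_def intro!: arg_cong2[of _ _ _ _ "(*)"] eq_matI less_imp_le)
  have "(\<Sum>f\<in>I. c f * x f powr 1) = m"
    unfolding m_def by (intro sum.cong) (use x in \<open>auto simp: less_imp_le\<close>)
  then have "delta_S_sq A B = ln m - 1 / 2 * ln D"
    using delta[of 1] by (simp only: mat_powr_one)
  then have delta_1: "t * delta_S_sq A B = ln (m powr t) - t / 2 * ln D"
    using m by (simp add: ln_powr right_diff_distrib)
  have pos: "0 < (\<Sum>f\<in>I. c f * x f powr t)"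
    by (rule weighted_mean_pos[OF c c1]) (use x in force)
  have "0 < m powr t" using m by simp
  note ln_le = ln_le_cancel_iff[OF pos this] ln_le_cancel_iff[OF this pos]
  \<comment> \<open>After cancelling the \<open>ln D\<close> terms and the logarithms, both claims
    compare the mean of the powers with the power of the mean.\<close>
  show ?thesis
    unfolding delta delta_1 diff_le_eq diff_add_cancel ln_le
    unfolding m_def using weighted_mean_powr_le[OF c c1 x, of t] weighted_mean_powr_ge[OF c c1 x, of t]
    by blast
qed

end
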